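(* Let $G$ be a claw-free graph with minimum degree $\delta(G)\geq 2$. Then $$\gamma(X(G)) \leq 4\gamma(G),$$ and this bound is attainable, i.e. there exists a claw-free graph $G$ with $\delta(G)\ge 2$ for which equality holds.
   Context: All graphs are finite and undirected with no loops or multiple edges. A graph is claw-free if it does not contain the complete bipartite graph $K_{1,3}$ as an induced subgraph. An arc of a graph $G$ is an ordered pair of adjacent vertices; $uv$ denotes the arc from $u$ to $v$ (so $uv\neq vu$). A $3$-arc of $G$ is a 4-tuple $(v,u,x,y)$ of vertices, possibly with $v=y$, such that both $(v,u,x)$ and $(u,x,y)$ are paths of $G$. The $3$-arc graph $X(G)$ of $G$ is the graph whose vertices are the arcs of $G$, where two arcs $uv$ and $xy$ are adjacent if and only if $(v,u,x,y)$ is a $3$-arc of $G$ (equivalently, $u,x$ are adjacent in $G$, $v\neq x$ and $y\neq u$). A dominating set of a graph is a set $S$ of vertices such that every vertex is in $S$ or adjacent to a vertex of $S$; the domination number $\gamma$ of a graph is the minimum cardinality of a dominating set. *)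

theory Defs
  imports "Graph_Theory.Graph_Theory"
begin

text \<open>
  Finite simple graphs are symmetric loop-free digraphs whose arcs are pairs of vertices
  (locale \<^locale>\<open>pair_graph\<close>), so that \<^term>\<open>parcs G\<close> is literally the set of ordered
  pairs of adjacent vertices.
\<close>

text \<open>
  The three notions below are stated for digraphs but intended for symmetric ones without parallel
  arcs: there \<^const>\<open>out_degree\<close> is the degree, and the direction of the dominating arc is
  irrelevant. \<open>min_degree\<close> is meaningful only for a nonempty finite vertex set.
\<close>

definition min_degree :: "('a, 'b) pre_digraph \<Rightarrow> nat" where
  "min_degree G = Min (out_degree G ` verts G)"

definition dominating_set :: "('a, 'b) pre_digraph \<Rightarrow> 'a set \<Rightarrow> bool" where
  "dominating_set G S \<longleftrightarrow>
     S \<subseteq> verts G \<and> (\<forall>v \<in> verts G. v \<in> S \<or> (\<exists>u \<in> S. u \<rightarrow>\<^bsub>G\<^esub> v))"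

definition domination_number :: "('a, 'b) pre_digraph \<Rightarrow> nat" where
  "domination_number G = Min (card ` {S. dominating_set G S})"

definition claw_free :: "('a, 'b) pre_digraph \<Rightarrow> bool" where
  "claw_free G \<longleftrightarrow> \<not> (\<exists>H. induced_subgraph H G \<and> K\<^bsub>1,3\<^esub> H)"

text \<open>Since \<^const>\<open>vpath\<close> requires distinct vertices only within each of the two
  paths, \<open>v = y\<close> is permitted.\<close>

definition three_arc :: "('a, 'b) pre_digraph \<Rightarrow> 'a \<times> 'a \<times> 'a \<times> 'a \<Rightarrow> bool" where
  "three_arc G = (\<lambda>(v, u, x, y). vpath [v, u, x] G \<and> vpath [u, x, y] G)"

definition three_arc_graph :: "'a pair_pre_digraph \<Rightarrow> ('a \<times> 'a) pair_pre_digraph" where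
  "three_arc_graph G = \<lparr>
     pverts = parcs G,
     parcs = {((u, v), (x, y)) | u v x y.
                (u, v) \<in> parcs G \<and> (x, y) \<in> parcs G \<and> three_arc G (v, u, x, y)} \<rparr>"

lemma (in pair_graph) three_arc_iff:
  assumes "(u, v) \<in> parcs G" "(x, y) \<in> parcs G"
  shows "three_arc G (v, u, x, y) \<longleftrightarrow> (u, x) \<in> parcs G \<and> v \<noteq> x \<and> y \<noteq> u"
  using assms
  by (auto simp: three_arc_def vpath_def vwalk_def dest: in_arcsD1 in_arcsD2 no_loops'
      intro: arcs_symmetric)

lemma (in pair_graph) pair_graph_three_arc_graph: "pair_graph (three_arc_graph G)"
proof -
  let ?X = "three_arc_graph G"
  have arcs_eq: "parcs ?X = {((u, v), (x, y)) | u v x y. (u, v) \<in> parcs G \<and> (x, y) \<in> parcs G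
      \<and> (u, x) \<in> parcs G \<and> v \<noteq> x \<and> y \<noteq> u}"
    unfolding three_arc_graph_def using three_arc_iff by auto
  have verts_eq: "pverts ?X = parcs G"
    by (simp add: three_arc_graph_def)
  have "parcs ?X \<subseteq> parcs G \<times> parcs G"
    unfolding arcs_eq by auto
  then have "finite (parcs ?X)"
    by (rule finite_subset) (simp add: pair_finite_arcs)
  moreover have "sym (parcs ?X)"
    unfolding arcs_eq by (auto intro!: symI intro: arcs_symmetric)
  ultimately show ?thesis
    by unfold_locales
      (auto simp: verts_eq arcs_eq symmetric_def pair_finite_arcs dest: no_loops')
qed

end

theory Submission
  imports Defs
begin

text \<open>
  Let \<open>s\<close> be a vertex of a dominating set of \<open>G\<close>. Four arcs dominate all arcs starting in the closed
  neighbourhood of \<open>s\<close>. Choose a neighbour \<open>d\<close> of \<open>s\<close>, a neighbour \<open>z \<noteq> s\<close> of \<open>d\<close>, and a neighbour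
  \<open>t \<noteq> d\<close> of \<open>z\<close>, where \<open>t = s\<close> if \<open>z\<close> is adjacent to \<open>s\<close>. Since \<open>G\<close> is claw-free, the neighbours
  of \<open>s\<close> other than \<open>d\<close> that are not adjacent to \<open>d\<close> form a clique \<open>K\<close>; let \<open>c \<in> K\<close>. Then \<open>sd\<close>
  dominates the arcs \<open>xy\<close> with \<open>x \<in> N(s) - {d}\<close> and \<open>y \<noteq> s\<close>, \<open>dz\<close> dominates the arcs from \<open>s\<close>
  and the arcs \<open>xs\<close> with \<open>x \<in> N(d) - {z}\<close>, \<open>zt\<close> dominates the arcs from \<open>d\<close> (and \<open>zs\<close>), and \<open>cs\<close>
  dominates the arcs \<open>xs\<close> with \<open>x \<in> K\<close>. Equality holds for two triangles sharing one vertex.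
\<close>

section \<open>Domination numbers and claws\<close>

lemma finite_dominating_sets:
  assumes "finite (verts G)"
  shows "finite {S. dominating_set G S}"
proof (rule finite_subset)
  show "{S. dominating_set G S} \<subseteq> Pow (verts G)"
    by (auto simp: dominating_set_def)
qed (use assms in simp)

lemma domination_number_le:
  assumes "finite (verts G)" "dominating_set G S"
  shows "domination_number G \<le> card S"
  unfolding domination_number_def using assms finite_dominating_sets by (intro Min_le) auto

lemma obtain_minimum_dominating_set:
  assumes "finite (verts G)"
  obtains S where "dominating_set G S" "card S = domination_number G"
proof -
  have "finite {S. dominating_set G S}"
    using assms by (rule finite_dominating_sets)
  \<comment> \<open>The full vertex set makes the family nonempty, so that \<open>Min\<close> is
    attained.\<close>
  moreover have "verts G \<in> {S. dominating_set G S}"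
    by (auto simp: dominating_set_def)
  ultimately have "domination_number G \<in> card ` {S. dominating_set G S}"
    unfolding domination_number_def by (intro Min_in) auto
  then show ?thesis
    using that by auto
qed

context pair_graph
begin

text \<open>Replaces the quantifier over induced subgraphs by a local test: the one-vertex side of a
  claw is its centre \<open>s\<close>, the other side three pairwise nonadjacent neighbours of
  \<open>s\<close>.\<close>

lemma claw_free_iff:
  "claw_free G \<longleftrightarrow>
     (\<forall>s a b c. (s, a) \<in> parcs G \<longrightarrow> (s, b) \<in> parcs G \<longrightarrow> (s, c) \<in> parcs G \<longrightarrow> distinct [a, b, c]
        \<longrightarrow> (a, b) \<in> parcs G \<or> (a, c) \<in> parcs G \<or> (b, c) \<in> parcs G)"
  (is "_ \<longleftrightarrow> ?R")
proof
  assume cf: "claw_free G"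
  show ?R
  proof (intro allI impI, rule ccontr)
    fix s a b c
    assume arcs: "(s, a) \<in> parcs G" "(s, b) \<in> parcs G" "(s, c) \<in> parcs G"
      and dist: "distinct [a, b, c]"
      and "\<not> ((a, b) \<in> parcs G \<or> (a, c) \<in> parcs G \<or> (b, c) \<in> parcs G)"
    then have non: "(a, b) \<notin> parcs G" "(a, c) \<notin> parcs G" "(b, c) \<notin> parcs G"
      "(b, a) \<notin> parcs G" "(c, a) \<notin> parcs G" "(c, b) \<notin> parcs G"
      using arcs_symmetric by blast+
    have s: "s \<notin> {a, b, c}"
      using arcs no_loops' by blast
    have loops: "(x, x) \<notin> parcs G" for x
      using no_loops' by blast
    define V where "V = {a, b, c}"
    have adj: "(x, y) \<in> parcs G \<longleftrightarrow> x = s \<and> y \<in> V \<or> y = s \<and> x \<in> V"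
      if "x \<in> insert s V" "y \<in> insert s V" for x y
    proof -
      have "a \<noteq> s" "b \<noteq> s" "c \<noteq> s"
        using s by auto
      with that[unfolded V_def] arcs arcs[THEN arcs_symmetric] non loops show ?thesis
        by (elim insertE emptyE) (simp_all add: V_def)
    qed
    define H where "H = \<lparr>pverts = insert s V,
      parcs = {e \<in> parcs G. fst e \<in> insert s V \<and> snd e \<in> insert s V}\<rparr>"
    have "pair_wf_digraph H"
      by unfold_locales (auto simp: H_def)
    then have "wf_digraph (with_proj H)"
      by (simp add: wf_digraph_wp_iff)
    moreover have "wf_digraph (with_proj G)"
      by unfold_locales
    moreover have "insert s V \<subseteq> pverts G"
      using arcs in_arcsD1 in_arcsD2 by (auto simp: V_def)
    ultimately have "induced_subgraph (with_proj H) (with_proj G)"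
      by (auto simp: induced_subgraph_def subgraph_def compatible_def H_def)
    moreover have "K\<^bsub>1,3\<^esub> (with_proj H)"
    proof -
      have "finite (pverts H)" "pverts H = {s} \<union> V" "{s} \<inter> V = {}" "card {s} = 1" "card V = 3"
        using dist s by (auto simp: H_def V_def)
      moreover have "parcs H = {s} \<times> V \<union> V \<times> {s}"
        using adj by (auto simp: H_def)
      ultimately show ?thesis
        unfolding complete_bipartite_digraph_pair_def by blast
    qed
    ultimately show False
      using cf unfolding claw_free_def by blast
  qed
next
  assume R: ?R
  show "claw_free G"
    unfolding claw_free_def
  proof
    assume "\<exists>H. induced_subgraph H (with_proj G) \<and> K\<^bsub>1,3\<^esub> H"
    then obtain H :: "('a, 'a \<times> 'a) pre_digraph"
      where ind: "induced_subgraph H (with_proj G)" and "K\<^bsub>1,3\<^esub> H"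
      by blast
    then obtain U V where UV: "verts H = U \<union> V" "U \<inter> V = {}" "card U = 1" "card V = 3"
      "arcs_ends H = U \<times> V \<union> V \<times> U"
      by (auto simp: complete_bipartite_digraph_def)
    obtain s where s: "U = {s}"
      using UV(3) by (rule card_1_singletonE)
    obtain a b c where abc: "V = {a, b, c}" "distinct [a, b, c]"
      using UV(4) by (auto simp: card_3_iff)
    \<comment> \<open>\<open>H\<close> inherits tail and head from \<open>G\<close>, where they are
      \<open>fst\<close> and \<open>snd\<close>, so its arcs coincide with their end pairs.\<close>
    have "arcs_ends H = {(x, y) \<in> parcs G. x \<in> verts H \<and> y \<in> verts H}"
      using ind by (auto simp: induced_subgraph_def subgraph_def compatible_def
          arcs_ends_def arc_to_ends_def image_iff)
    then have "(x, y) \<in> parcs G \<longleftrightarrow> (x, y) \<in> U \<times> V \<union> V \<times> U"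
      if "x \<in> U \<union> V" "y \<in> U \<union> V" for x y
      using that UV(1,5) by blast
    then show False
      using R[rule_format, of s a b c] UV(2) s abc by auto
  qed
qed

lemma out_degree_eq: "out_degree G v = card {w. (v, w) \<in> parcs G}"
proof -
  have "out_arcs G v = Pair v ` {w. (v, w) \<in> parcs G}"
    by (auto simp: out_arcs_def)
  then show ?thesis
    by (simp add: out_degree_def card_image inj_on_def)
qed

text \<open>Lets a neighbour be chosen away from one prescribed vertex \<open>x\<close>: two or more
  neighbours cannot all lie in \<open>{x}\<close>.\<close>

lemma min_degree_ge_2_other_neighbour:
  assumes "min_degree G \<ge> 2" "v \<in> pverts G"
  obtains w where "(v, w) \<in> parcs G" "w \<noteq> x"
proof -
  have "min_degree G \<le> out_degree G v"
    unfolding min_degree_def using assms(2) pair_finite_verts by (intro Min_le) auto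
  then have "\<not> card {w. (v, w) \<in> parcs G} \<le> card {x}"
    using assms(1) by (simp add: out_degree_eq)
  then have "\<not> {w. (v, w) \<in> parcs G} \<subseteq> {x}"
    using card_mono[of "{x}"] by blast
  then show ?thesis
    using that by auto
qed

lemma pverts_three_arc_graph: "pverts (three_arc_graph G) = parcs G"
  by (simp add: three_arc_graph_def)

lemma three_arc_graph_arc_iff:
  "((u, v), (x, y)) \<in> parcs (three_arc_graph G) \<longleftrightarrow>
     (u, v) \<in> parcs G \<and> (x, y) \<in> parcs G \<and> (u, x) \<in> parcs G \<and> v \<noteq> x \<and> y \<noteq> u"
  by (auto simp: three_arc_graph_def three_arc_iff)

section \<open>The upper bound\<close>

text \<open>The local form of the bound, with adjacency in the 3-arc graph spelled out in
  \<open>G\<close>. An inequality for \<open>card A\<close> allows the four arcs to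
  coincide.\<close>

lemma four_arcs_dominate_closed_neighbourhood:
  assumes cf: "claw_free G" and deg: "min_degree G \<ge> 2" and s: "s \<in> pverts G"
  shows "\<exists>A \<subseteq> parcs G. card A \<le> 4 \<and>
    (\<forall>x y. (x, y) \<in> parcs G \<longrightarrow> x = s \<or> (s, x) \<in> parcs G \<longrightarrow>
       (x, y) \<in> A \<or> (\<exists>(u, v) \<in> A. (u, x) \<in> parcs G \<and> v \<noteq> x \<and> y \<noteq> u))"
proof -
  obtain d where d: "(s, d) \<in> parcs G"
    using min_degree_ge_2_other_neighbour[OF deg s] by blast
  obtain z where z: "(d, z) \<in> parcs G" "z \<noteq> s"
    using min_degree_ge_2_other_neighbour[OF deg in_arcsD2[OF d]] by blast
  \<comment> \<open>If \<open>z\<close> is adjacent to \<open>s\<close>, the arc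
    \<open>(z, s)\<close> escapes \<open>(d, z)\<close>, whose head is \<open>z\<close>; taking
    \<open>t = s\<close> puts it into \<open>A\<close>.\<close>
  obtain t where t: "(z, t) \<in> parcs G" "t \<noteq> d" "(s, z) \<in> parcs G \<Longrightarrow> t = s"
  proof (cases "(s, z) \<in> parcs G")
    case True
    then show ?thesis
      using that d no_loops' arcs_symmetric by blast
  next
    case False
    then show ?thesis
      using that min_degree_ge_2_other_neighbour[OF deg in_arcsD2[OF z(1)]] by blast
  qed
  define K where "K = {x. (s, x) \<in> parcs G \<and> x \<noteq> d \<and> (d, x) \<notin> parcs G}"
  \<comment> \<open>For empty \<open>K\<close> any neighbour of \<open>s\<close> serves as a
    default, keeping \<open>(c, s)\<close> an arc.\<close>
  obtain c where c: "(s, c) \<in> parcs G" "K \<noteq> {} \<Longrightarrow> c \<in> K"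
    using d by (cases "K = {}") (auto simp: K_def)
  \<comment> \<open>Otherwise \<open>s\<close> would be the centre of a claw with leaves
    \<open>d\<close>, \<open>c\<close>, \<open>x\<close>.\<close>
  have K: "x = c \<or> (c, x) \<in> parcs G" if "x \<in> K" for x
  proof -
    have "c \<in> K"
      using c(2) that by blast
    then show ?thesis
      using cf[unfolded claw_free_iff, rule_format, of s d c x] d that by (auto simp: K_def)
  qed
  define A where "A = {(s, d), (d, z), (z, t), (c, s)}"
  have sub: "A \<subseteq> parcs G"
    using d z t c arcs_symmetric by (auto simp: A_def)
  have card: "card A \<le> 4"
    unfolding A_def by (simp add: card_insert_if)
  have "(x, y) \<in> A \<or> (\<exists>(u, v) \<in> A. (u, x) \<in> parcs G \<and> v \<noteq> x \<and> y \<noteq> u)"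
    if xy: "(x, y) \<in> parcs G" and x: "x = s \<or> (s, x) \<in> parcs G" for x y
  proof -
    have s_ne: "s \<noteq> x" if "(s, x) \<in> parcs G"
      using that no_loops' by blast
    \<comment> \<open>The dominating arcs are, in order, \<open>(d, z)\<close>,
      \<open>(z, t)\<close>, \<open>(s, d)\<close>, \<open>(c, s)\<close> and \<open>(d, z)\<close>.
      The exceptions \<open>(s, d)\<close>, \<open>(d, z)\<close>, \<open>(c, s)\<close> and, for
      \<open>x = z\<close>, \<open>(z, s)\<close> belong to \<open>A\<close> themselves.\<close>
    consider "x = s" | "x = d" | "(s, x) \<in> parcs G" "x \<noteq> d" "y \<noteq> s"
      | "(s, x) \<in> parcs G" "x \<noteq> d" "y = s" "x \<in> K"
      | "(s, x) \<in> parcs G" "x \<noteq> d" "y = s" "(d, x) \<in> parcs G"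
      using x by (auto simp: K_def)
    then show ?thesis
    proof cases
      case 1
      then show ?thesis
        using z d arcs_symmetric by (auto simp: A_def)
    next
      case 2
      then show ?thesis
        using z t arcs_symmetric by (auto simp: A_def)
    next
      case 3
      then show ?thesis
        by (auto simp: A_def)
    next
      case 4
      then show ?thesis
        using K s_ne c(1) no_loops' by (auto simp: A_def)
    next
      case 5
      then show ?thesis
        using t d no_loops' by (cases "x = z") (auto simp: A_def)
    qed
  qed
  then show ?thesis
    using sub card by blast
qed

text \<open>The tail of every arc lies in the closed neighbourhood of some member of a minimum
  dominating set, so the union of the local sets dominates.\<close>

lemma domination_number_three_arc_graph_le:
  assumes "claw_free G" "min_degree G \<ge> 2"
  shows "domination_number (three_arc_graph G) \<le> 4 * domination_number G"
proof -
  obtain S where S: "dominating_set G S" "card S = domination_number G"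
    using obtain_minimum_dominating_set[of "with_proj G"] pair_finite_verts by auto
  have sub: "S \<subseteq> pverts G"
    using S(1) by (simp add: dominating_set_def)
  then have fin: "finite S"
    using pair_finite_verts finite_subset by blast
  have "\<forall>s \<in> S. \<exists>A \<subseteq> parcs G. card A \<le> 4 \<and>
    (\<forall>x y. (x, y) \<in> parcs G \<longrightarrow> x = s \<or> (s, x) \<in> parcs G \<longrightarrow>
       (x, y) \<in> A \<or> (\<exists>(u, v) \<in> A. (u, x) \<in> parcs G \<and> v \<noteq> x \<and> y \<noteq> u))"
    using four_arcs_dominate_closed_neighbourhood[OF assms] sub by blast
  from bchoice[OF this] obtain A where A: "\<forall>s \<in> S. A s \<subseteq> parcs G \<and> card (A s) \<le> 4 \<and>
    (\<forall>x y. (x, y) \<in> parcs G \<longrightarrow> x = s \<or> (s, x) \<in> parcs G \<longrightarrow>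
       (x, y) \<in> A s \<or> (\<exists>(u, v) \<in> A s. (u, x) \<in> parcs G \<and> v \<noteq> x \<and> y \<noteq> u))" ..
  have arcs: "A s \<subseteq> parcs G" and card: "card (A s) \<le> 4" if "s \<in> S" for s
    using A that by blast+
  let ?T = "\<Union>s \<in> S. A s"
  have "dominating_set (three_arc_graph G) ?T"
    unfolding dominating_set_def with_proj_simps pverts_three_arc_graph
  proof (intro conjI ballI)
    show "?T \<subseteq> parcs G"
      using arcs by blast
    fix e
    assume e: "e \<in> parcs G"
    obtain x y where xy: "e = (x, y)"
      by force
    have "x \<in> pverts G"
      using e xy in_arcsD1 by blast
    then obtain s where s: "s \<in> S" "x = s \<or> (s, x) \<in> parcs G"
      using S(1) by (auto simp: dominating_set_def)
    consider "e \<in> A s" | u v where "(u, v) \<in> A s" "(u, x) \<in> parcs G" "v \<noteq> x" "y \<noteq> u"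
      using A[rule_format, OF s(1)] s(2) e xy by blast
    then show "e \<in> ?T \<or> (\<exists>f \<in> ?T. (f, e) \<in> parcs (three_arc_graph G))"
    proof cases
      case 1
      then show ?thesis
        using s(1) by blast
    next
      case 2
      then have "((u, v), e) \<in> parcs (three_arc_graph G)"
        using arcs[OF s(1)] e by (auto simp: xy three_arc_graph_arc_iff)
      then show ?thesis
        using 2(1) s(1) by blast
    qed
  qed
  then have "domination_number (three_arc_graph G) \<le> card ?T"
    using pair_finite_arcs by (intro domination_number_le) (simp_all add: pverts_three_arc_graph)
  also have "\<dots> \<le> (\<Sum>s \<in> S. card (A s))"
    using fin by (rule card_UN_le)
  also have "\<dots> \<le> (\<Sum>s \<in> S. 4)"
    using card by (rule sum_mono)
  finally show ?thesis
    using S(2) by simp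
qed

end

section \<open>Sharpness\<close>

definition bow_tie :: "nat pair_pre_digraph" where
  "bow_tie = \<lparr>pverts = {0, 1, 2, 3, 4},
     parcs = {(0, 1), (0, 2), (0, 3), (0, 4), (1, 0), (2, 0), (3, 0), (4, 0),
              (1, 2), (2, 1), (3, 4), (4, 3)}\<rparr>"

lemma pair_graph_bow_tie: "pair_graph bow_tie"
  by unfold_locales (auto simp: bow_tie_def symmetric_def sym_def)

interpretation bow_tie: pair_graph bow_tie
  by (rule pair_graph_bow_tie)

lemma neighbours_bow_tie:
  assumes "v \<in> pverts bow_tie"
  shows "{w. (v, w) \<in> parcs bow_tie} =
    (if v = 0 then {1, 2, 3, 4}
     else {0, if v = 1 then 2 else if v = 2 then 1 else if v = 3 then 4 else 3})"
  using assms by (auto simp: bow_tie_def)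

text \<open>Only \<open>0\<close> has three neighbours, and these split into the edges 12 and 34, so
  any three of them include an adjacent pair.\<close>

lemma claw_free_bow_tie: "claw_free bow_tie"
  unfolding bow_tie.claw_free_iff
proof (intro allI impI)
  fix s a b c
  assume arcs: "(s, a) \<in> parcs bow_tie" "(s, b) \<in> parcs bow_tie" "(s, c) \<in> parcs bow_tie"
    and dist: "distinct [a, b, c]"
  then have nbrs: "a \<in> {w. (s, w) \<in> parcs bow_tie}" "b \<in> {w. (s, w) \<in> parcs bow_tie}"
    "c \<in> {w. (s, w) \<in> parcs bow_tie}"
    by simp_all
  have s: "s \<in> pverts bow_tie"
    using arcs(1) by (rule bow_tie.in_arcsD1)
  note nbrs = nbrs[unfolded neighbours_bow_tie[OF s]]
  have "s = 0"
  proof (rule ccontr)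
    assume "s \<noteq> 0"
    have "a \<noteq> b" "a \<noteq> c" "b \<noteq> c"
      using dist by auto
    then show False
      using nbrs[unfolded if_not_P[OF \<open>s \<noteq> 0\<close>]] by blast
  qed
  moreover have "{(1, 2), (2, 1), (3, 4), (4, 3)} \<subseteq> parcs bow_tie"
    by (simp add: bow_tie_def)
  ultimately show "(a, b) \<in> parcs bow_tie \<or> (a, c) \<in> parcs bow_tie \<or> (b, c) \<in> parcs bow_tie"
    using nbrs dist by auto
qed

lemma min_degree_bow_tie: "min_degree bow_tie \<ge> 2"
proof -
  have "out_degree bow_tie v \<ge> 2" if "v \<in> pverts bow_tie" for v
    using that by (simp add: bow_tie.out_degree_eq neighbours_bow_tie)
  moreover have "finite (pverts bow_tie)" "pverts bow_tie \<noteq> {}"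
    by (simp_all add: bow_tie_def)
  ultimately show ?thesis
    by (simp add: min_degree_def)
qed

lemma domination_number_bow_tie_le: "domination_number bow_tie \<le> 1"
proof -
  have "dominating_set bow_tie {0}"
    by (auto simp: dominating_set_def bow_tie_def)
  then have "domination_number bow_tie \<le> card {0 :: nat}"
    using bow_tie.pair_finite_verts by (intro domination_number_le) simp_all
  then show ?thesis
    by simp
qed

text \<open>Each triangle forces an arc with head \<open>0\<close>, and dominating the arcs from
  \<open>0\<close> forces two further arcs with nonzero head.\<close>

lemma dominating_set_three_arc_graph_bow_tie_card:
  assumes "dominating_set (three_arc_graph bow_tie) T"
  shows "card T \<ge> 4"
proof -
  have sub: "T \<subseteq> parcs bow_tie"
    using assms by (simp add: dominating_set_def bow_tie.pverts_three_arc_graph)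
  have dom: "(x, y) \<in> T \<or> (\<exists>u v. (u, v) \<in> T \<and> (u, x) \<in> parcs bow_tie \<and> v \<noteq> x \<and> y \<noteq> u)"
    if "(x, y) \<in> parcs bow_tie" for x y
    using assms that unfolding dominating_set_def
    by (fastforce simp: bow_tie.pverts_three_arc_graph bow_tie.three_arc_graph_arc_iff)
  \<comment> \<open>An arc dominating \<open>(1, 0)\<close> has its tail adjacent to
    \<open>1\<close> but different from \<open>0\<close>, hence tail \<open>2\<close>, and its head
    is not \<open>1\<close>: only \<open>(2, 0)\<close> remains.\<close>
  have "(1, 0) \<in> T \<or> (2, 0) \<in> T"
    using dom[of 1 0] sub by (auto simp: bow_tie_def)
  then obtain p where p: "p \<in> {1, 2}" "(p, 0) \<in> T"
    by blast
  have "(3, 0) \<in> T \<or> (4, 0) \<in> T"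
    using dom[of 3 0] sub by (auto simp: bow_tie_def)
  then obtain q where q: "q \<in> {3, 4}" "(q, 0) \<in> T"
    by blast
  \<comment> \<open>Only arcs with nonzero head dominate arcs from \<open>0\<close>, and each of them misses one such arc.\<close>
  have from0: "(0, y) \<in> T \<or> (\<exists>u v. (u, v) \<in> T \<and> u \<noteq> 0 \<and> v \<noteq> 0 \<and> y \<noteq> u)"
    if "y \<in> {1, 2, 3, 4}" for y
  proof -
    have "(0, y) \<in> parcs bow_tie" "\<And>u. (u, 0) \<in> parcs bow_tie \<Longrightarrow> u \<noteq> 0"
      using that by (auto simp: bow_tie_def)
    then show ?thesis
      using dom[of 0 y] by blast
  qed
  obtain u v where uv: "(u, v) \<in> T" "v \<noteq> 0"
    using from0[of 1] by auto
  \<comment> \<open>Chosen so that \<open>(u, v)\<close> neither equals nor dominates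
    \<open>(0, y)\<close>: for \<open>u \<noteq> 0\<close> it misses \<open>(0, u)\<close>, and for
    \<open>u = 0\<close> it suffices that \<open>y \<noteq> v\<close>.\<close>
  define y where "y = (if u \<noteq> 0 then u else if v = 1 then 2 else 1)"
  have "y \<in> {1, 2, 3, 4}"
    using uv sub by (auto simp: y_def bow_tie_def)
  from from0[OF this] obtain u' v' where uv': "(u', v') \<in> T" "v' \<noteq> 0" "(u', v') \<noteq> (u, v)"
    using \<open>y \<in> {1, 2, 3, 4}\<close> by (auto simp: y_def split: if_splits)
  have "card {(p, 0), (q, 0), (u, v), (u', v')} = 4"
    using p(1) q(1) uv(2) uv'(2,3) by auto
  moreover have "finite T"
    using sub bow_tie.pair_finite_arcs finite_subset by blast
  ultimately show ?thesis
    using p(2) q(2) uv(1) uv'(1) card_mono[of T "{(p, 0), (q, 0), (u, v), (u', v')}"] by simp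
qed

text \<open>The lower bound 4, the general upper bound and the dominating set \<open>{0}\<close>
  close the chain from 4 to 4.\<close>

lemma domination_number_three_arc_graph_bow_tie:
  "domination_number (three_arc_graph bow_tie) = 4 * domination_number bow_tie"
proof -
  have "finite (verts (three_arc_graph bow_tie))"
    using bow_tie.pair_finite_arcs by (simp add: bow_tie.pverts_three_arc_graph)
  then have "4 \<le> domination_number (three_arc_graph bow_tie)"
    using dominating_set_three_arc_graph_bow_tie_card obtain_minimum_dominating_set by metis
  then show ?thesis
    using bow_tie.domination_number_three_arc_graph_le[OF claw_free_bow_tie min_degree_bow_tie]
      domination_number_bow_tie_le by linarith
qed

theorem theorem7:
  shows "(\<forall>G :: 'a pair_pre_digraph.
            pair_graph G \<and> pverts G \<noteq> {} \<and> claw_free G \<and> min_degree G \<ge> 2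
            \<longrightarrow> domination_number (three_arc_graph G) \<le> 4 * domination_number G)
       \<and> (\<exists>G :: nat pair_pre_digraph.
            pair_graph G \<and> pverts G \<noteq> {} \<and> claw_free G \<and> min_degree G \<ge> 2
            \<and> domination_number (three_arc_graph G) = 4 * domination_number G)"
proof
  show "\<forall>G :: 'a pair_pre_digraph.
          pair_graph G \<and> pverts G \<noteq> {} \<and> claw_free G \<and> min_degree G \<ge> 2
          \<longrightarrow> domination_number (three_arc_graph G) \<le> 4 * domination_number G"
    using pair_graph.domination_number_three_arc_graph_le by blast
  have "pverts bow_tie \<noteq> {}"
    by (simp add: bow_tie_def)
  then show "\<exists>G :: nat pair_pre_digraph.
          pair_graph G \<and> pverts G \<noteq> {} \<and> claw_free G \<and> min_degree G \<ge> 2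
          \<and> domination_number (three_arc_graph G) = 4 * domination_number G"
    using pair_graph_bow_tie claw_free_bow_tie min_degree_bow_tie
      domination_number_three_arc_graph_bow_tie by blast
qed

end
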